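(* Under the $m\Pi$-hypothesis, for the Barab\'asi-Albert (BA) model with $k\ge m$, the steady-state degree distribution $P(k):=\lim_{t\to\infty}P(k,t)$ exists, is independent of the initial network, and is given by $$P(k)=\frac{2m(m+1)}{k(k+1)(k+2)}\ \sim\ 2m^2k^{-3}>0 .$$
   Context: BA model. Let $m\le m_0$ be positive integers. The network starts with a complete graph on $m_0$ vertices, labelled $-m_0,\dots,-1$, with total degree $N_0=m_0(m_0-1)$. At every time step a new vertex is added with $m$ edges that link it to $m$ different vertices already present; the vertex added at time $i$ is labelled $i$, $i=1,2,\dots$. Thus at time $t$ there are $t+m_0$ vertices, labelled by the integers $i$ with $-m_0\le i\le t$, $i\ne 0$, and the total degree is $2mt+N_0$. Let $k_i(t)$ be the degree of vertex $i$ at time $t$, regarded as a random variable; $k_i(i)=m$ for $i\ge1$. $m\Pi$-hypothesis. The probability that an existing vertex with degree $k_i$ receives a new connection from the new vertex is exactly $m\Pi(k_i)$, where $\Pi(k_i)=k_i/\sum_j k_j$, the sum being over all vertices already present. Under this hypothesis $k_i(t)$ is, as $t$ varies, a nonhomogeneous Markov chain with state-transition probabilities $$P\{k_i(t+1)=l\mid k_i(t)=k\}=\begin{cases}1-\dfrac{k}{2t+N_0/m}, & l=k,\\[4pt] \dfrac{k}{2t+N_0/m}, & l=k+1,\\[4pt] 0,&\text{otherwise,}\end{cases}$$ for $k=1,2,\dots,m+t-i$ and $i=1,2,\dots$. Notation. $P(k,i,t)=P\{k_i(t)=k\}$ is the probability that vertex $i$ has degree $k$ at time $t$, and the network degree distribution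 at time $t$ is the average over all vertices, $$P(k,t)=\frac{1}{t+m_0}\sum_{\substack{i=-m_0\\ i\neq0}}^{t}P(k,i,t).$$
   Formalization: For fixed m, P(k)/(2m²k⁻³) tends to 1+1/m, not 1, so "∼" fails as asymptotic equivalence when k→∞; it is instead stated as ratio → 1 when m and k both tend to infinity with k ≥ m, and as equal order of magnitude in k for each fixed m. *)

theory Defs
  imports "HOL-Probability.Probability" "HOL-Library.Landau_Symbols"
begin

definition ba_vertices :: "nat \<Rightarrow> nat \<Rightarrow> int set" where
  "ba_vertices m0 t = {- int m0..int t} - {0}"

text \<open>A history \<open>h\<close> assigns to every time \<open>s \<ge> 1\<close> the set \<open>h s\<close> of vertices to which the
  new vertex \<open>s\<close> is linked. The values of \<open>h\<close> at times other than \<open>1, \<dots>, t\<close> play no role for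
  the network at time \<open>t\<close>.\<close>

definition ba_edges :: "nat \<Rightarrow> (nat \<Rightarrow> int set) \<Rightarrow> nat \<Rightarrow> int set set" where
  "ba_edges m0 h t =
     {{i, j} | i j. i \<in> ba_vertices m0 0 \<and> j \<in> ba_vertices m0 0 \<and> i \<noteq> j} \<union>
     {{int s, j} | s j. 1 \<le> s \<and> s \<le> t \<and> j \<in> h s}"

definition ba_degree :: "nat \<Rightarrow> (nat \<Rightarrow> int set) \<Rightarrow> nat \<Rightarrow> int \<Rightarrow> nat" where
  "ba_degree m0 h t i = card {e \<in> ba_edges m0 h t. i \<in> e}"

definition ba_total_degree :: "nat \<Rightarrow> (nat \<Rightarrow> int set) \<Rightarrow> nat \<Rightarrow> nat" where
  "ba_total_degree m0 h t = (\<Sum>j\<in>ba_vertices m0 t. ba_degree m0 h t j)"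

definition ba_Pi :: "nat \<Rightarrow> (nat \<Rightarrow> int set) \<Rightarrow> nat \<Rightarrow> int \<Rightarrow> real" where
  "ba_Pi m0 h t i = real (ba_degree m0 h t i) / real (ba_total_degree m0 h t)"

locale ba_model = prob_space M for M :: "'a measure" +
  fixes m m0 :: nat and target :: "nat \<Rightarrow> 'a \<Rightarrow> int set"
  assumes m_pos: "0 < m" and m_le_m0: "m \<le> m0"
    and target_measurable:
      "\<And>t. target (Suc t) \<in> M \<rightarrow>\<^sub>M count_space {A. A \<subseteq> ba_vertices m0 t \<and> card A = m}"

text \<open>The attachment probability is conditional on the network at time \<open>t\<close>, which (being a
  labelled graph) records all links made up to time \<open>t\<close>. Since the total degree is
  \<open>2 * m * t + m0 * (m0 - 1)\<close>, the degree of each vertex \<open>i \<ge> 1\<close> is then a Markov chain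
  moving from \<open>k\<close> to \<open>k + 1\<close> with probability \<open>k / (2 * t + m0 * (m0 - 1) / m)\<close>.
  The total degree vanishes only if \<open>m0 = 1\<close> and \<open>t = 0\<close>: then the preference function is
  \<open>0 / 0\<close>, and the only possible step links the first new vertex to the single initial one.\<close>

locale ba_model_mPi = ba_model +
  assumes mPi:
    "\<And>t h i. i \<in> ba_vertices m0 t \<Longrightarrow> ba_total_degree m0 h t > 0 \<Longrightarrow>
       \<P>(\<omega> in M. \<forall>s\<in>{1..t}. target s \<omega> = h s) > 0 \<Longrightarrow>
       \<P>(\<omega> in M. i \<in> target (Suc t) \<omega> \<bar> \<forall>s\<in>{1..t}. target s \<omega> = h s) = real m * ba_Pi m0 h t i"

definition ba_vertex_degree_dist ::
    "'a measure \<Rightarrow> nat \<Rightarrow> (nat \<Rightarrow> 'a \<Rightarrow> int set) \<Rightarrow> nat \<Rightarrow> int \<Rightarrow> nat \<Rightarrow> real" where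
  "ba_vertex_degree_dist M m0 target k i t = \<P>(\<omega> in M. ba_degree m0 (\<lambda>s. target s \<omega>) t i = k)"

definition ba_degree_dist ::
    "'a measure \<Rightarrow> nat \<Rightarrow> (nat \<Rightarrow> 'a \<Rightarrow> int set) \<Rightarrow> nat \<Rightarrow> nat \<Rightarrow> real" where
  "ba_degree_dist M m0 target k t =
     (\<Sum>i\<in>ba_vertices m0 t. ba_vertex_degree_dist M m0 target k i t) / real (t + m0)"

end

theory Submission
  imports Defs "HOL-Real_Asymp.Real_Asymp"
begin

text \<open>Conditioning on the finitely many possible histories up to time \<open>t\<close> shows that the expected
  number \<open>N k t\<close> of vertices of degree \<open>k\<close> satisfies, with \<open>T\<^sub>0\<close> the initial total degree and
  \<open>c = T\<^sub>0 / (2 * m)\<close>,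
  \<open>N k (t + 1) = (1 - k / 2 / (t + c)) * N k t + (k - 1) / 2 / (t + c) * N (k - 1) t + [k = m]\<close>
  for \<open>t \<ge> 1\<close>. A solution of \<open>a (t + 1) = (1 - b / (t + c)) * a t + g t\<close> with \<open>g \<longlonglongrightarrow> l\<close> differs
  from \<open>l / (1 + b) * (t + c)\<close> by an error whose absolute value grows by at most \<open>\<bar>g t - l\<bar>\<close> in
  each step, so \<open>a t / t \<longlonglongrightarrow> l / (1 + b)\<close>. Induction on \<open>k\<close>, starting from degree \<open>0\<close> because
  initial vertices may have degree \<open>m - 1\<close>, gives the limit of \<open>N k t / t\<close>.\<close>


subsection \<open>Linear recurrences\<close>

text \<open>Past some \<open>n\<close> every increment is at most \<open>r / 2\<close>, so
  \<open>\<bar>e t\<bar>\<close> stays below a line of slope \<open>r / 2\<close>. The other half of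
  \<open>r * t\<close> absorbs the constant \<open>\<bar>e n\<bar>\<close> once
  \<open>t > 2 * \<bar>e n\<bar> / r\<close>.\<close>

lemma slow_growth_limit:
  fixes e d :: "nat \<Rightarrow> real"
  assumes step: "\<forall>\<^sub>F t in sequentially. \<bar>e (Suc t)\<bar> \<le> \<bar>e t\<bar> + d t"
    and d: "d \<longlonglongrightarrow> 0"
  shows "(\<lambda>t. e t / real t) \<longlonglongrightarrow> 0"
proof (rule tendsto_0_le[where K = 1])
  show "(\<lambda>t. e t / real t) \<longlonglongrightarrow> 0"
  proof (rule LIMSEQ_I)
    fix r :: real assume r: "0 < r"
    have "\<forall>\<^sub>F t in sequentially. d t < r / 2"
      using order_tendstoD(2)[OF d, of "r / 2"] r by simp
    with step have "\<forall>\<^sub>F t in sequentially. \<bar>e (Suc t)\<bar> \<le> \<bar>e t\<bar> + r / 2"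
      by eventually_elim simp
    then obtain n where n: "\<And>t. n \<le> t \<Longrightarrow> \<bar>e (Suc t)\<bar> \<le> \<bar>e t\<bar> + r / 2"
      by (auto simp: eventually_sequentially)
    have bound: "\<bar>e t\<bar> \<le> \<bar>e n\<bar> + r / 2 * (real t - real n)" if "n \<le> t" for t
      using that
    proof (induction t rule: dec_induct)
      case (step t)
      then show ?case using n[of t] by (simp add: field_simps)
    qed simp
    obtain n' :: nat where n': "2 * \<bar>e n\<bar> / r < real n'"
      using reals_Archimedean2 by blast
    show "\<exists>no. \<forall>t\<ge>no. norm (e t / real t - 0) < r"
    proof (intro exI allI impI)
      fix t assume t: "max (max n n') 1 \<le> t"
      have "2 * \<bar>e n\<bar> < r * real n'"
        using n' r by (simp add: field_simps)
      also have "\<dots> \<le> r * real t"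
        using t r by simp
      finally have "\<bar>e n\<bar> < r / 2 * real t"
        by simp
      moreover have "\<bar>e t\<bar> \<le> \<bar>e n\<bar> + r / 2 * real t"
        using bound[of t] t mult_nonneg_nonneg[of "r / 2" "real n"] r
        unfolding right_diff_distrib by linarith
      ultimately have "\<bar>e t\<bar> < r * real t"
        by simp
      then show "norm (e t / real t - 0) < r"
        using t by (simp add: field_simps abs_divide)
    qed
  qed
qed simp

lemma linear_recurrence_limit:
  fixes a g :: "nat \<Rightarrow> real"
  assumes rec: "\<forall>\<^sub>F t in sequentially. a (Suc t) = (1 - b / (real t + c)) * a t + g t"
    and g: "g \<longlonglongrightarrow> l" and b: "0 \<le> b"
  shows "(\<lambda>t. a t / real t) \<longlonglongrightarrow> l / (1 + b)"
proof -
  \<comment> \<open>The slope for which \<open>L * (t + c)\<close> solves the recurrence exactly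
    with constant input \<open>l\<close>: this requires \<open>L + b * L = l\<close>.\<close>
  define L where "L = l / (1 + b)"
  define e where "e t = a t - L * (real t + c)" for t
  have L: "L + b * L = l"
  proof -
    have "L + b * L = l / (1 + b) * (1 + b)"
      by (simp add: L_def add_divide_distrib distrib_left mult.commute)
    then show ?thesis using b by simp
  qed
  have pos: "\<forall>\<^sub>F t in sequentially. 0 < real t + c"
    by real_asymp
  \<comment> \<open>From here on the multiplier \<open>1 - b / (t + c)\<close> lies between 0 and 1,
    so it cannot enlarge the error.\<close>
  have le: "\<forall>\<^sub>F t in sequentially. b \<le> real t + c"
    by real_asymp
  have "(\<lambda>t. e t / real t) \<longlonglongrightarrow> 0"
  proof (rule slow_growth_limit[where d = "\<lambda>t. \<bar>g t - l\<bar>"])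
    show "\<forall>\<^sub>F t in sequentially. \<bar>e (Suc t)\<bar> \<le> \<bar>e t\<bar> + \<bar>g t - l\<bar>"
      using rec pos le
    proof eventually_elim
      case (elim t)
      have "e (Suc t) = (1 - b / (real t + c)) * a t + g t - L * (real t + c) - L"
        using elim(1) by (simp add: e_def algebra_simps)
      also have "\<dots> = (1 - b / (real t + c)) * e t + g t - (L + b * L)"
        using elim(2) by (simp add: e_def field_simps)
      finally have eq: "e (Suc t) = (1 - b / (real t + c)) * e t + (g t - l)"
        using L by simp
      have "\<bar>1 - b / (real t + c)\<bar> \<le> 1"
        using elim(2,3) b by (simp add: abs_le_iff field_simps)
      then have "\<bar>(1 - b / (real t + c)) * e t\<bar> \<le> \<bar>e t\<bar>"
        by (simp add: abs_mult mult_left_le_one_le)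
      with eq show ?case by linarith
    qed
    show "(\<lambda>t. \<bar>g t - l\<bar>) \<longlonglongrightarrow> 0"
      using g by (simp add: LIM_zero tendsto_rabs_zero)
  qed
  moreover have "(\<lambda>t. L * ((real t + c) / real t)) \<longlonglongrightarrow> L * 1"
    by (intro tendsto_mult tendsto_const) real_asymp
  ultimately have "(\<lambda>t. e t / real t + L * ((real t + c) / real t)) \<longlonglongrightarrow> 0 + L * 1"
    by (rule tendsto_add)
  then show ?thesis
    by (simp add: L_def e_def diff_divide_distrib)
qed


subsection \<open>Degrees along a history\<close>

text \<open>The range condition of \<open>target_measurable\<close> for one fixed history, so that
  degree facts can be proved without probability. Vertex \<open>Suc s\<close> sees exactly the
  vertices present at time \<open>s\<close>.\<close>

definition ba_history :: "nat \<Rightarrow> nat \<Rightarrow> nat \<Rightarrow> (nat \<Rightarrow> int set) \<Rightarrow> bool" where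
  "ba_history m m0 t h \<longleftrightarrow>
     (\<forall>s<t. h (Suc s) \<subseteq> ba_vertices m0 s \<and> card (h (Suc s)) = m)"

lemma ba_history_Suc:
  "ba_history m m0 (Suc t) h \<longleftrightarrow>
     ba_history m m0 t h \<and> h (Suc t) \<subseteq> ba_vertices m0 t \<and> card (h (Suc t)) = m"
  by (auto simp: ba_history_def less_Suc_eq)

lemma finite_ba_vertices [simp]: "finite (ba_vertices m0 t)"
  by (simp add: ba_vertices_def)

lemma ba_vertices_Suc: "ba_vertices m0 (Suc t) = insert (int (Suc t)) (ba_vertices m0 t)"
  by (auto simp: ba_vertices_def)

lemma new_vertex_notin: "int (Suc t) \<notin> ba_vertices m0 t"
  by (simp add: ba_vertices_def)

lemma ba_edges_Suc:
  "ba_edges m0 h (Suc t) = ba_edges m0 h t \<union> (\<lambda>j. {int (Suc t), j}) ` h (Suc t)"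
proof -
  have "{{int s, j} | s j. 1 \<le> s \<and> s \<le> Suc t \<and> j \<in> h s} =
      {{int s, j} | s j. 1 \<le> s \<and> s \<le> t \<and> j \<in> h s} \<union> (\<lambda>j. {int (Suc t), j}) ` h (Suc t)"
    (is "?L = ?R")
  proof
    show "?L \<subseteq> ?R" by (fastforce simp: le_Suc_eq simp del: of_nat_Suc)
    show "?R \<subseteq> ?L" by (fastforce simp del: of_nat_Suc)
  qed
  then show ?thesis
    unfolding ba_edges_def by (simp only: Un_assoc)
qed

text \<open>Guarantees that an edge at vertex \<open>Suc t\<close> is absent at time
  \<open>t\<close>, so the edges added in a step are genuinely new and degrees add up.\<close>

lemma ba_edges_subset:
  "ba_history m m0 t h \<Longrightarrow> e \<in> ba_edges m0 h t \<Longrightarrow> e \<subseteq> ba_vertices m0 t"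
proof (induction t)
  case 0
  then show ?case by (auto simp: ba_edges_def)
next
  case (Suc t)
  then show ?case
    by (auto simp: ba_edges_Suc ba_history_Suc ba_vertices_Suc)
qed

lemma finite_ba_edges: "ba_history m m0 t h \<Longrightarrow> finite (ba_edges m0 h t)"
  by (rule finite_subset[of _ "Pow (ba_vertices m0 t)"]) (auto dest: ba_edges_subset)

lemma ba_degree_Suc_old:
  assumes "ba_history m m0 (Suc t) h" and i: "i \<in> ba_vertices m0 t"
  shows "ba_degree m0 h (Suc t) i = ba_degree m0 h t i + of_bool (i \<in> h (Suc t))"
proof -
  have h: "ba_history m m0 t h"
    using assms by (simp add: ba_history_Suc)
  have ne: "i \<noteq> int (Suc t)"
    using i new_vertex_notin by blast
  have "{e \<in> ba_edges m0 h (Suc t). i \<in> e} =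
      {e \<in> ba_edges m0 h t. i \<in> e} \<union> (if i \<in> h (Suc t) then {{int (Suc t), i}} else {})"
    using ne by (auto simp: ba_edges_Suc)
  moreover have "{int (Suc t), i} \<notin> ba_edges m0 h t"
    using ba_edges_subset[OF h] new_vertex_notin by blast
  ultimately show ?thesis
    using finite_ba_edges[OF h] by (simp add: ba_degree_def)
qed

lemma ba_degree_Suc_new:
  assumes "ba_history m m0 (Suc t) h"
  shows "ba_degree m0 h (Suc t) (int (Suc t)) = m"
proof -
  have h: "ba_history m m0 t h" and hs: "h (Suc t) \<subseteq> ba_vertices m0 t" "card (h (Suc t)) = m"
    using assms by (simp_all add: ba_history_Suc)
  have "{e \<in> ba_edges m0 h (Suc t). int (Suc t) \<in> e} = (\<lambda>j. {int (Suc t), j}) ` h (Suc t)"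
    using ba_edges_subset[OF h] new_vertex_notin[of t m0] by (fastforce simp: ba_edges_Suc simp del: of_nat_Suc)
  moreover have "inj_on (\<lambda>j. {int (Suc t), j}) (h (Suc t))"
    by (auto simp: inj_on_def doubleton_eq_iff)
  ultimately show ?thesis
    using hs(2) by (simp add: ba_degree_def card_image)
qed

text \<open>A step adds \<open>m\<close> for the new vertex and \<open>m\<close> spread over its
  targets. The total is thus the same for all valid histories. The initial value stays unevaluated,
  since only its being constant matters in the limit.\<close>

lemma ba_total_degree_eq:
  "ba_history m m0 t h \<Longrightarrow> ba_total_degree m0 h t = ba_total_degree m0 (\<lambda>_. {}) 0 + 2 * m * t"
proof (induction t)
  case 0
  then show ?case by (simp add: ba_total_degree_def ba_degree_def ba_edges_def)
next
  case (Suc t)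
  have h: "ba_history m m0 t h" and hs: "h (Suc t) \<subseteq> ba_vertices m0 t" "card (h (Suc t)) = m"
    using Suc.prems by (simp_all add: ba_history_Suc)
  have "(\<Sum>i\<in>ba_vertices m0 t. of_bool (i \<in> h (Suc t))) = m"
    using hs by (simp add: Int_absorb1 flip: Int_def)
  then have "ba_total_degree m0 h (Suc t) = m + (ba_total_degree m0 h t + m)"
    using new_vertex_notin[of t m0] ba_degree_Suc_new[OF Suc.prems]
    by (simp add: ba_total_degree_def ba_vertices_Suc ba_degree_Suc_old[OF Suc.prems] sum.distrib
        del: of_nat_Suc)
  then show ?case
    using Suc.IH[OF h] by simp
qed

lemma ba_degree_cong:
  assumes "\<And>s. s \<in> {1..t} \<Longrightarrow> h s = h' s"
  shows "ba_degree m0 h t i = ba_degree m0 h' t i"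
proof -
  have "ba_edges m0 h t = ba_edges m0 h' t"
    using assms unfolding ba_edges_def by fastforce
  then show ?thesis by (simp add: ba_degree_def)
qed


subsection \<open>Conditioning on the history\<close>

text \<open>Measurability is asked only of the atoms
  \<open>X \<omega> = x \<and> A \<omega>\<close>. Since \<open>X\<close> takes finitely many
  values, \<open>Q\<close> may be arbitrary and no sigma-algebra on the values of \<open>X\<close>
  is required.\<close>

lemma (in prob_space) prob_finite_partition:
  assumes "finite F" and "\<And>\<omega>. \<omega> \<in> space M \<Longrightarrow> X \<omega> \<in> F"
    and "\<And>x. x \<in> F \<Longrightarrow> {\<omega> \<in> space M. X \<omega> = x \<and> A \<omega>} \<in> events"
  shows "{\<omega> \<in> space M. Q (X \<omega>) \<and> A \<omega>} \<in> events"
    and "\<P>(\<omega> in M. Q (X \<omega>) \<and> A \<omega>) = (\<Sum>x\<in>{x \<in> F. Q x}. \<P>(\<omega> in M. X \<omega> = x \<and> A \<omega>))"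
proof -
  have eq: "{\<omega> \<in> space M. Q (X \<omega>) \<and> A \<omega>} =
      (\<Union>x\<in>{x \<in> F. Q x}. {\<omega> \<in> space M. X \<omega> = x \<and> A \<omega>})"
    using assms(2) by auto
  show "{\<omega> \<in> space M. Q (X \<omega>) \<and> A \<omega>} \<in> events"
    unfolding eq using assms by (intro sets.finite_UN) auto
  show "\<P>(\<omega> in M. Q (X \<omega>) \<and> A \<omega>) = (\<Sum>x\<in>{x \<in> F. Q x}. \<P>(\<omega> in M. X \<omega> = x \<and> A \<omega>))"
    unfolding eq using assms by (intro finite_measure_finite_Union) (auto simp: disjoint_family_on_def)
qed

context ba_model
begin

text \<open>The targets take values in a \<open>count_space\<close>, on which every predicate is
  measurable.\<close>

lemma pred_target [measurable]: "Measurable.pred M (\<lambda>\<omega>. R (target (Suc s) \<omega>))"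
  by (rule measurable_compose[OF target_measurable]) simp

lemma target_history:
  assumes "\<omega> \<in> space M"
  shows "ba_history m m0 t (\<lambda>s. target s \<omega>)"
  using measurable_space[OF target_measurable assms] by (simp add: ba_history_def)

text \<open>Fixing the values outside \<open>{1..t}\<close> makes equality of histories the same as
  agreement on \<open>{1..t}\<close>, and leaves only finitely many histories.\<close>

definition history :: "nat \<Rightarrow> 'a \<Rightarrow> nat \<Rightarrow> int set" where
  "history t \<omega> = restrict (\<lambda>s. target s \<omega>) {1..t}"

definition histories :: "nat \<Rightarrow> (nat \<Rightarrow> int set) set" where
  "histories t = history t ` space M"

lemma ba_degree_history: "ba_degree m0 (history t \<omega>) t i = ba_degree m0 (\<lambda>s. target s \<omega>) t i"
  by (rule ba_degree_cong) (simp add: history_def)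

lemma history_eq_iff:
  assumes "h \<in> histories t"
  shows "history t \<omega> = h \<longleftrightarrow> (\<forall>s\<in>{1..t}. target s \<omega> = h s)"
  using assms by (auto simp: histories_def history_def restrict_def fun_eq_iff)

lemma histories_valid: "h \<in> histories t \<Longrightarrow> ba_history m m0 t h"
  using target_history by (fastforce simp: histories_def history_def ba_history_def)

lemma finite_histories: "finite (histories t)"
proof (rule finite_subset)
  show "histories t \<subseteq> PiE {1..t} (\<lambda>_. Pow (ba_vertices m0 t))"
  proof
    fix h assume h: "h \<in> histories t"
    have "h s \<subseteq> ba_vertices m0 t" if "s \<in> {1..t}" for s
    proof -
      have "h s \<subseteq> ba_vertices m0 (s - 1)"
        using histories_valid[OF h] that unfolding ba_history_def
        by (metis One_nat_def Suc_le_eq Suc_pred atLeastAtMost_iff)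
      also have "\<dots> \<subseteq> ba_vertices m0 t"
        using that by (auto simp: ba_vertices_def)
      finally show ?thesis .
    qed
    then show "h \<in> PiE {1..t} (\<lambda>_. Pow (ba_vertices m0 t))"
      using h by (fastforce simp: histories_def history_def)
  qed
qed (intro finite_PiE; simp)

lemma history_event:
  assumes "h \<in> histories t" and [measurable]: "Measurable.pred M A"
  shows "{\<omega> \<in> space M. history t \<omega> = h \<and> A \<omega>} \<in> events"
proof -
  \<comment> \<open>Times are reindexed as successors because \<open>pred_target\<close> speaks of
    \<open>target (Suc s)\<close> only.\<close>
  have "{\<omega> \<in> space M. history t \<omega> = h \<and> A \<omega>} =
      {\<omega> \<in> space M. (\<forall>s\<in>{..<t}. target (Suc s) \<omega> = h (Suc s)) \<and> A \<omega>}"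
    unfolding history_eq_iff[OF assms(1)] image_Suc_lessThan[symmetric] by simp
  also have "\<dots> \<in> events"
    by measurable
  finally show ?thesis .
qed

lemma prob_history_partition:
  assumes "Measurable.pred M A"
  shows "{\<omega> \<in> space M. Q (history t \<omega>) \<and> A \<omega>} \<in> events"
    and "\<P>(\<omega> in M. Q (history t \<omega>) \<and> A \<omega>) =
      (\<Sum>h\<in>{h \<in> histories t. Q h}. \<P>(\<omega> in M. history t \<omega> = h \<and> A \<omega>))"
  using prob_finite_partition[OF finite_histories, of "history t" t A Q] history_event[OF _ assms]
  by (simp_all add: histories_def)

lemma pred_degree [measurable]: "Measurable.pred M (\<lambda>\<omega>. ba_degree m0 (\<lambda>s. target s \<omega>) t i = k)"
  using prob_history_partition(1)[of "\<lambda>_. True" "\<lambda>h. ba_degree m0 h t i = k" t]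
  by (simp add: ba_degree_history pred_def)

end

section \<open>Degree transitions under the attachment hypothesis\<close>

context ba_model_mPi
begin

text \<open>Split by histories: whenever vertex \<open>i\<close> has degree \<open>k\<close>, the
  conditional attachment probability is the same number, because the total degree depends on
  \<open>t\<close> alone. Positivity of \<open>t\<close> makes the total degree positive, as
  \<open>mPi\<close> demands.\<close>

lemma attachment_prob:
  assumes t: "0 < t" and i: "i \<in> ba_vertices m0 t"
  shows "\<P>(\<omega> in M. ba_degree m0 (\<lambda>s. target s \<omega>) t i = k \<and> i \<in> target (Suc t) \<omega>) =
    real m * real k / real (ba_total_degree m0 (\<lambda>_. {}) 0 + 2 * m * t) *
      ba_vertex_degree_dist M m0 target k i t"
    (is "_ = ?c * _")
proof -
  let ?F = "{h \<in> histories t. ba_degree m0 h t i = k}"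
  \<comment> \<open>The conjunct \<open>True\<close> matches \<open>prob_history_partition\<close>
    with a trivial \<open>A\<close>.\<close>
  have step: "\<P>(\<omega> in M. history t \<omega> = h \<and> i \<in> target (Suc t) \<omega>) = ?c * \<P>(\<omega> in M. history t \<omega> = h \<and> True)"
    if "h \<in> ?F" for h
  proof -
    have h: "h \<in> histories t" and k: "ba_degree m0 h t i = k"
      using that by auto
    let ?H = "\<lambda>\<omega>. \<forall>s\<in>{1..t}. target s \<omega> = h s"
    note total = ba_total_degree_eq[OF histories_valid[OF h]]
    show ?thesis
    proof (cases "\<P>(\<omega> in M. ?H \<omega>) > 0")
      case True
      have "\<P>(\<omega> in M. i \<in> target (Suc t) \<omega> \<bar> ?H \<omega>) = real m * ba_Pi m0 h t i"
        using mPi[OF i _ True] total t m_pos by simp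
      then have "\<P>(\<omega> in M. i \<in> target (Suc t) \<omega> \<and> ?H \<omega>) = ?c * \<P>(\<omega> in M. ?H \<omega>)"
        using True total k by (simp add: cond_prob_def ba_Pi_def field_simps)
      then show ?thesis
        by (simp add: history_eq_iff[OF h] conj_commute)
    next
      \<comment> \<open>For a history of probability zero \<open>mPi\<close> says nothing, but both
        sides vanish.\<close>
      case False
      then have 0: "\<P>(\<omega> in M. history t \<omega> = h \<and> True) = 0"
        by (simp add: history_eq_iff[OF h] zero_less_measure_iff)
      have "\<P>(\<omega> in M. history t \<omega> = h \<and> i \<in> target (Suc t) \<omega>) \<le> \<P>(\<omega> in M. history t \<omega> = h \<and> True)"
        by (rule finite_measure_mono) (use history_event[OF h, of "\<lambda>_. True"] in auto)
      with 0 show ?thesis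
        by (simp add: order_antisym)
    qed
  qed
  have "\<P>(\<omega> in M. ba_degree m0 (\<lambda>s. target s \<omega>) t i = k \<and> i \<in> target (Suc t) \<omega>) =
      (\<Sum>h\<in>?F. \<P>(\<omega> in M. history t \<omega> = h \<and> i \<in> target (Suc t) \<omega>))"
    using prob_history_partition(2)[of "\<lambda>\<omega>. i \<in> target (Suc t) \<omega>" "\<lambda>h. ba_degree m0 h t i = k" t]
    by (simp add: ba_degree_history)
  also have "\<dots> = ?c * (\<Sum>h\<in>?F. \<P>(\<omega> in M. history t \<omega> = h \<and> True))"
    using step by (simp add: sum_distrib_left)
  also have "(\<Sum>h\<in>?F. \<P>(\<omega> in M. history t \<omega> = h \<and> True)) = ba_vertex_degree_dist M m0 target k i t"
    using prob_history_partition(2)[of "\<lambda>_. True" "\<lambda>h. ba_degree m0 h t i = k" t]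
    by (simp add: ba_degree_history ba_vertex_degree_dist_def)
  finally show ?thesis .
qed

text \<open>For \<open>k = 0\<close> the truncated \<open>k - 1\<close> is \<open>0\<close>, so the second summand correctly vanishes.\<close>

lemma vertex_degree_dist_Suc_old:
  assumes t: "0 < t" and i: "i \<in> ba_vertices m0 t"
  defines "T \<equiv> real (ba_total_degree m0 (\<lambda>_. {}) 0 + 2 * m * t)"
  shows "ba_vertex_degree_dist M m0 target k i (Suc t) =
    (1 - real m * real k / T) * ba_vertex_degree_dist M m0 target k i t +
    real m * real (k - 1) / T * ba_vertex_degree_dist M m0 target (k - 1) i t"
proof -
  let ?d = "\<lambda>\<omega>. ba_degree m0 (\<lambda>s. target s \<omega>) t i" and ?A = "\<lambda>\<omega>. i \<in> target (Suc t) \<omega>"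
  note attach = attachment_prob[OF t i, folded T_def]
  have stay: "\<P>(\<omega> in M. ?d \<omega> = k) = \<P>(\<omega> in M. ?d \<omega> = k \<and> \<not> ?A \<omega>) + \<P>(\<omega> in M. ?d \<omega> = k \<and> ?A \<omega>)"
    by (subst finite_measure_Union[symmetric]) (auto intro!: arg_cong[where f = prob])
  \<comment> \<open>Degree \<open>k\<close> arises by staying at \<open>k\<close> or by gaining a
    link at \<open>k - 1\<close>. The guard \<open>0 < k\<close> matters: a linked vertex of degree
    0 moves to degree 1, not to \<open>0 = 0 - 1\<close>.\<close>
  have "\<P>(\<omega> in M. ba_degree m0 (\<lambda>s. target s \<omega>) (Suc t) i = k) =
      \<P>(\<omega> in M. (?d \<omega> = k \<and> \<not> ?A \<omega>) \<or> (0 < k \<and> ?d \<omega> = k - 1 \<and> ?A \<omega>))"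
    using ba_degree_Suc_old[OF target_history i]
    by (intro arg_cong[where f = prob]) auto
  also have "\<dots> = \<P>(\<omega> in M. ?d \<omega> = k \<and> \<not> ?A \<omega>) + \<P>(\<omega> in M. 0 < k \<and> ?d \<omega> = k - 1 \<and> ?A \<omega>)"
    by (subst finite_measure_Union[symmetric]) (auto intro!: arg_cong[where f = prob])
  also have "\<P>(\<omega> in M. 0 < k \<and> ?d \<omega> = k - 1 \<and> ?A \<omega>) =
      real m * real (k - 1) / T * ba_vertex_degree_dist M m0 target (k - 1) i t"
    using attach[of "k - 1"] by (cases k) simp_all
  finally show ?thesis
    using stay attach[of k] by (simp add: ba_vertex_degree_dist_def algebra_simps)
qed

lemma vertex_degree_dist_Suc_new:
  "ba_vertex_degree_dist M m0 target k (int (Suc t)) (Suc t) = of_bool (k = m)"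
proof -
  have "ba_degree m0 (\<lambda>s. target s \<omega>) (Suc t) (int (Suc t)) = m" if "\<omega> \<in> space M" for \<omega>
    using ba_degree_Suc_new[OF target_history[OF that]] .
  then have "{\<omega> \<in> space M. ba_degree m0 (\<lambda>s. target s \<omega>) (Suc t) (int (Suc t)) = k} =
      (if k = m then space M else {})"
    by auto
  then show ?thesis
    unfolding ba_vertex_degree_dist_def by (simp add: prob_space)
qed

section \<open>Expected degree counts and their growth rates\<close>

definition expected_count :: "nat \<Rightarrow> nat \<Rightarrow> real" where
  "expected_count k t = (\<Sum>i\<in>ba_vertices m0 t. ba_vertex_degree_dist M m0 target k i t)"

lemma expected_count_Suc:
  assumes t: "0 < t"
  defines "T \<equiv> real (ba_total_degree m0 (\<lambda>_. {}) 0 + 2 * m * t)"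
  shows "expected_count k (Suc t) =
    (1 - real m * real k / T) * expected_count k t +
    (real m * real (k - 1) / T * expected_count (k - 1) t + of_bool (k = m))"
  using new_vertex_notin[of t m0] vertex_degree_dist_Suc_old[OF t, folded T_def]
  by (simp add: expected_count_def ba_vertices_Suc vertex_degree_dist_Suc_new sum.distrib
      sum_distrib_left del: of_nat_Suc)

text \<open>An instance of \<open>linear_recurrence_limit\<close> with \<open>b = k / 2\<close>. The
  inflow from degree \<open>k - 1\<close> together with the new vertex forms the input
  \<open>g\<close>.\<close>

lemma expected_count_limit_step:
  assumes lim: "(\<lambda>t. expected_count (k - 1) t / real t) \<longlonglongrightarrow> p"
  shows "(\<lambda>t. expected_count k t / real t) \<longlonglongrightarrow> (real (k - 1) / 2 * p + of_bool (k = m)) / (1 + real k / 2)"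
proof -
  \<comment> \<open>The initial network enters the coefficients only through this shift, which the
    limit does not see.\<close>
  define c where "c = real (ba_total_degree m0 (\<lambda>_. {}) 0) / (2 * real m)"
  define g where "g t = real (k - 1) / 2 / (real t + c) * expected_count (k - 1) t + of_bool (k = m)" for t
  have T: "real m * x / real (ba_total_degree m0 (\<lambda>_. {}) 0 + 2 * m * t) = x / 2 / (real t + c)" for x t
  proof -
    have "real (ba_total_degree m0 (\<lambda>_. {}) 0 + 2 * m * t) = 2 * real m * (real t + c)"
      using m_pos by (simp add: c_def field_simps)
    then show ?thesis
      using m_pos by simp
  qed
  show ?thesis
  proof (rule linear_recurrence_limit)
    show "\<forall>\<^sub>F t in sequentially. expected_count k (Suc t) =
        (1 - real k / 2 / (real t + c)) * expected_count k t + g t"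
      using eventually_gt_at_top[of 0]
      by eventually_elim (simp add: expected_count_Suc T g_def del: of_nat_add)
    have "(\<lambda>t. real t / (real t + c)) \<longlonglongrightarrow> 1"
      by real_asymp
    then have "(\<lambda>t. real (k - 1) / 2 * ((real t / (real t + c)) * (expected_count (k - 1) t / real t)) +
        of_bool (k = m)) \<longlonglongrightarrow> real (k - 1) / 2 * (1 * p) + of_bool (k = m)"
      using lim by (intro tendsto_intros)
    moreover have "\<forall>\<^sub>F t in sequentially. real (k - 1) / 2 * ((real t / (real t + c)) *
        (expected_count (k - 1) t / real t)) + of_bool (k = m) = g t"
      using eventually_gt_at_top[of 0] by eventually_elim (simp add: g_def)
    ultimately show "g \<longlonglongrightarrow> real (k - 1) / 2 * p + of_bool (k = m)"
      using Lim_transform_eventually by fastforce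
  qed simp
qed

lemma expected_count_limit:
  "(\<lambda>t. expected_count k t / real t) \<longlonglongrightarrow>
     (if k < m then 0 else 2 * real m * (real m + 1) / (real k * (real k + 1) * (real k + 2)))"
proof (induction k)
  case 0
  \<comment> \<open>At \<open>k = 0\<close> the multiplier is 1 and there is no input, since
    \<open>m > 0\<close>. The count is constant only from time 1 on, where the recurrence
    starts.\<close>
  have "expected_count 0 (Suc t) = expected_count 0 1" for t
    using m_pos by (induction t) (simp_all add: expected_count_Suc)
  then have "(\<lambda>t. expected_count 0 (Suc t) / real (Suc t)) = (\<lambda>t. expected_count 0 1 / real (Suc t))"
    by (intro ext) (rule arg_cong)
  also have "\<dots> \<longlonglongrightarrow> 0"
    by (rule LIMSEQ_Suc[OF lim_const_over_n])
  finally have "(\<lambda>t. expected_count 0 (Suc t) / real (Suc t)) \<longlonglongrightarrow> 0" .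
  then show ?case
    using m_pos LIMSEQ_imp_Suc[of "\<lambda>t. expected_count 0 t / real t"] by simp
next
  case (Suc k)
  let ?p = "if k < m then 0 else 2 * real m * (real m + 1) / (real k * (real k + 1) * (real k + 2))"
  consider "Suc k < m" | "Suc k = m" | "m \<le> k" by linarith
  then have "(real k / 2 * ?p + of_bool (Suc k = m)) / (1 + real (Suc k) / 2) =
      (if Suc k < m then 0
       else 2 * real m * (real m + 1) / (real (Suc k) * (real (Suc k) + 1) * (real (Suc k) + 2)))"
  proof cases
    \<comment> \<open>Nothing flows in from degree \<open>m - 1\<close> in the limit; the new
      vertices alone give \<open>1 / (1 + m / 2) = 2 / (m + 2)\<close>, the claimed value at degree
      \<open>m\<close>.\<close>
    case 2
    then have "real m = real k + 1" by auto
    with 2 show ?thesis by (simp add: divide_simps)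
  next
    \<comment> \<open>The recursion multiplies the limit by \<open>k / (k + 3)\<close>, the ratio of
      consecutive values of the closed form.\<close>
    case 3
    then have k: "real k > 0" using m_pos by simp
    have "real k / 2 * (2 * real m * (real m + 1) / (real k * (real k + 1) * (real k + 2))) =
      real m * (real m + 1) / ((real k + 1) * (real k + 2))"
      using k by simp
    moreover have "x / ((real k + 1) * (real k + 2)) / (1 + (1 + real k) / 2) =
        2 * x / ((1 + real k) * (2 + real k) * (3 + real k))" for x
      using k by (simp add: divide_simps) (simp add: add.commute)
    ultimately show ?thesis using 3 by (simp add: add_ac mult.assoc)
  qed simp
  then show ?case
    using expected_count_limit_step[of "Suc k", simplified diff_Suc_1, OF Suc.IH] by simp
qed

lemma degree_dist_limit:
  assumes "m \<le> k"
  shows "(\<lambda>t. ba_degree_dist M m0 target k t) \<longlonglongrightarrow>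
    2 * real m * (real m + 1) / (real k * (real k + 1) * (real k + 2))"
    (is "_ \<longlonglongrightarrow> ?p")
proof -
  have "(\<lambda>t. real t / (real t + real m0)) \<longlonglongrightarrow> 1"
    by real_asymp
  with expected_count_limit[of k]
  have "(\<lambda>t. (expected_count k t / real t) * (real t / (real t + real m0))) \<longlonglongrightarrow> ?p * 1"
    using assms by (intro tendsto_mult) (simp_all add: not_less)
  moreover have "\<forall>\<^sub>F t in sequentially. (expected_count k t / real t) * (real t / (real t + real m0)) =
      ba_degree_dist M m0 target k t"
    using eventually_gt_at_top[of 0]
    by eventually_elim (simp add: ba_degree_dist_def expected_count_def)
  ultimately show ?thesis
    using Lim_transform_eventually by fastforce
qed

end


subsection \<open>The steady-state distribution\<close>

text \<open>For fixed \<open>m\<close> the quotient of the two sides tends to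
  \<open>1 + 1 / m\<close> as \<open>k\<close> grows, so equivalence calls for \<open>m\<close>
  tending to infinity as well. It is the product of an equivalence in \<open>m\<close> and one in
  \<open>k\<close>, each pulled back along a projection.\<close>

lemma power_law_asymp_equiv:
  "(\<lambda>(m, k). 2 * real m * (real m + 1) / (real k * (real k + 1) * (real k + 2)))
      \<sim>[at_top \<times>\<^sub>F at_top] (\<lambda>(m, k). 2 * (real m)\<^sup>2 * real k powr (-3))"
proof -
  have "(\<lambda>m. 2 * real m * (real m + 1)) \<sim>[at_top] (\<lambda>m. 2 * (real m)\<^sup>2)"
    by real_asymp
  then have "(\<lambda>x :: nat \<times> nat. 2 * real (fst x) * (real (fst x) + 1))
      \<sim>[at_top \<times>\<^sub>F at_top] (\<lambda>x. 2 * (real (fst x))\<^sup>2)"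
    by (rule asymp_equiv_compose') (rule filterlim_fst)
  moreover have "(\<lambda>k. 1 / (real k * (real k + 1) * (real k + 2))) \<sim>[at_top] (\<lambda>k. real k powr (-3))"
    by real_asymp
  then have "(\<lambda>x :: nat \<times> nat. 1 / (real (snd x) * (real (snd x) + 1) * (real (snd x) + 2)))
      \<sim>[at_top \<times>\<^sub>F at_top] (\<lambda>x. real (snd x) powr (-3))"
    by (rule asymp_equiv_compose') (rule filterlim_snd)
  ultimately show ?thesis
    using asymp_equiv_mult by (fastforce simp: case_prod_unfold)
qed

text \<open>Choosing \<open>P\<close> before \<open>m0\<close>, \<open>M\<close> and
  \<open>target\<close> expresses independence of the initial network. The equivalence is joint in
  \<open>m\<close> and \<open>k\<close>; for fixed \<open>m\<close> the order of magnitude is given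
  by \<open>\<Theta>\<close>.\<close>

theorem theorem1:
  shows "\<exists>P :: nat \<Rightarrow> nat \<Rightarrow> real.
    (\<forall>m m0 (M :: 'a measure) target k. ba_model_mPi M m m0 target \<longrightarrow> m \<le> k \<longrightarrow>
        (\<lambda>t. ba_degree_dist M m0 target k t) \<longlonglongrightarrow> P m k) \<and>
    (\<forall>m k. 0 < m \<longrightarrow> m \<le> k \<longrightarrow>
        P m k = 2 * real m * (real m + 1) / (real k * (real k + 1) * (real k + 2)) \<and>
        P m k > 0 \<and> 2 * (real m)\<^sup>2 * real k powr (-3) > 0) \<and>
    (\<lambda>(m, k). P m k)
        \<sim>[inf (at_top \<times>\<^sub>F at_top) (principal {(m, k). m \<le> k})]
      (\<lambda>(m, k). 2 * (real m)\<^sup>2 * real k powr (-3)) \<and>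
    (\<forall>m. 0 < m \<longrightarrow> P m \<in> \<Theta>(\<lambda>k. 2 * (real m)\<^sup>2 * real k powr (-3)))"
proof (intro exI[of _ "\<lambda>m k. 2 * real m * (real m + 1) / (real k * (real k + 1) * (real k + 2))"]
    conjI allI impI)
  fix m :: nat assume "0 < m"
  then show "(\<lambda>k. 2 * real m * (real m + 1) / (real k * (real k + 1) * (real k + 2)))
      \<in> \<Theta>(\<lambda>k. 2 * (real m)\<^sup>2 * real k powr (-3))"
    by real_asymp
\<comment> \<open>Restricting to \<open>m \<le> k\<close> yields a smaller filter, so the limit of
  the quotient carries over from the full product filter.\<close>
qed (auto intro: ba_model_mPi.degree_dist_limit filterlim_mono[OF power_law_asymp_equiv[unfolded asymp_equiv_def]] simp: asymp_equiv_def)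

end
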